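(* Let $n\ge 1$ and $r\ge 1$ be integers. Let $F_{r,n}$ be the number of fixed points of the permutation obtained after $r$ iterated random-to-top shuffles of an $n$-card deck, starting from the identity. Let $K_{r,n}$ be the number of occupied boxes when $r$ balls are thrown independently and uniformly at random into $n$ boxes, and let $\pi$ be a uniformly random permutation of $[n]$, independent of $K_{r,n}$. Then $F_{r,n}$ is equal in distribution to $$n-\max_{1\leq i\leq K_{r,n}}\pi(i)+\sum_{i=1}^{K_{r,n}}\mathbf{1}(\pi(i)=i).$$
   Context: A deck of $n$ cards labelled $1,\dots,n$ in some order is encoded by the permutation $\sigma$ of $[n]=\{1,\dots,n\}$ where $\sigma(i)$ is the card in position $i$ (position $1$ is the top). A random-to-top shuffle selects one of the $n$ cards uniformly at random (the top card may be selected) and moves it to the top, keeping the relative order of the other cards. Iterated random-to-top shuffles start from the deck in order $12\cdots n$ and perform the selections independently. A fixed point of $\sigma$ is an index $i\in[n]$ with $\sigma(i)=i$. $\mathbf{1}(A)$ is the indicator of the event $A$. *)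

theory Defs
  imports "HOL-Probability.Probability" "HOL-Probability.Product_PMF" "HOL-Combinatorics.Permutations"
begin

text \<open>
  A deck is a permutation \<open>\<sigma>\<close> of \<open>{1..n}\<close>, with \<open>\<sigma> i\<close> the card in position \<open>i\<close> and position 1 the
  top; \<open>inv \<sigma> c\<close> is the position of card \<open>c\<close>. Moving \<open>c\<close> to the top pushes the cards that were
  above it down by one position.
\<close>

definition move_to_top :: "nat \<Rightarrow> (nat \<Rightarrow> nat) \<Rightarrow> nat \<Rightarrow> nat" where
  "move_to_top c \<sigma> i =
     (if i = 1 then c else if 1 < i \<and> i \<le> inv \<sigma> c then \<sigma> (i - 1) else \<sigma> i)"

lemma move_to_top_permutes:
  assumes \<sigma>: "\<sigma> permutes {1..n}" and c: "c \<in> {1..n}"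
  shows "move_to_top c \<sigma> permutes {1..n}"
proof (rule bij_imp_permutes)
  define p where "p = inv \<sigma> c"
  have p: "p \<in> {1..n}" "\<sigma> p = c"
    using \<sigma> c permutes_in_image[OF permutes_inv[OF \<sigma>]] permutes_inverses(1)[OF \<sigma>]
    unfolding p_def by blast+
  have eq: "move_to_top c \<sigma> i = (if i = 1 then \<sigma> p else if 1 < i \<and> i \<le> p then \<sigma> (i - 1) else \<sigma> i)"
    for i unfolding move_to_top_def p_def[symmetric] p(2) ..
  have img: "move_to_top c \<sigma> ` {1..n} \<subseteq> {1..n}"
  proof (rule image_subsetI)
    fix i assume i: "i \<in> {1..n}"
    have "\<sigma> j \<in> {1..n}" if "j \<in> {1..n}" for j
      using that permutes_in_image[OF \<sigma>] by blast
    moreover have "i - 1 \<in> {1..n}" if "1 < i" using i that by auto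
    ultimately show "move_to_top c \<sigma> i \<in> {1..n}"
      using i p(1) unfolding eq by presburger
  qed
  have inj: "inj_on (move_to_top c \<sigma>) {1..n}"
    using p(1) by (auto intro!: inj_onI simp: eq inj_eq[OF permutes_inj[OF \<sigma>]] split: if_splits)
  show "bij_betw (move_to_top c \<sigma>) {1..n} {1..n}"
    using inj img by (simp add: bij_betw_def endo_inj_surj)
  show "move_to_top c \<sigma> i = i" if "i \<notin> {1..n}" for i
    using that p(1) permutes_not_in[OF \<sigma> that] by (auto simp: eq)
qed

primrec random_to_top :: "nat \<Rightarrow> nat \<Rightarrow> (nat \<Rightarrow> nat) pmf" where
  "random_to_top n 0 = return_pmf id"
| "random_to_top n (Suc r) =
     bind_pmf (random_to_top n r)
       (\<lambda>\<sigma>. map_pmf (\<lambda>c. move_to_top c \<sigma>) (pmf_of_set {1..n}))"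

definition num_fixed_points :: "nat \<Rightarrow> (nat \<Rightarrow> nat) \<Rightarrow> nat" where
  "num_fixed_points n \<sigma> = card {i \<in> {1..n}. \<sigma> i = i}"

text \<open>
  The ball \<open>j < r\<close> lands in box \<open>b j\<close>; the value 0 is only the default of \<^const>\<open>Pi_pmf\<close> at
  indices that are not balls.
\<close>

definition occupied_boxes :: "nat \<Rightarrow> nat \<Rightarrow> nat pmf" where
  "occupied_boxes r n =
     map_pmf (\<lambda>b. card (b ` {..<r})) (Pi_pmf {..<r} 0 (\<lambda>_. pmf_of_set {1..n}))"

end

theory Submission imports Defs begin

text \<open>
  Encode the selected cards by a word \<open>b\<close>, whose set of letters \<open>S\<close> has \<open>K\<close> elements. The top \<open>K\<close>
  cards of the final deck are those in \<open>S\<close> and the remaining ones are in increasing order, so an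
  untouched card is a fixed point iff it exceeds \<open>Max S\<close>. Relabelling the word by a permutation \<open>\<pi>\<close>
  preserves its uniform law and relabels the top \<open>K\<close> cards by \<open>\<pi>\<close>. For uniform \<open>\<pi>\<close> the relabelled
  top cards are therefore, given \<open>b\<close>, the first \<open>K\<close> values of a uniform permutation.
\<close>

section \<open>Decks as functions of the word of selected cards\<close>

primrec deck_of_word :: "nat \<Rightarrow> (nat \<Rightarrow> nat) \<Rightarrow> nat \<Rightarrow> nat" where
  "deck_of_word 0 b = id"
| "deck_of_word (Suc r) b = move_to_top (b r) (deck_of_word r b)"

lemma deck_of_word_cong:
  assumes "\<And>j. j < r \<Longrightarrow> b j = b' j"
  shows "deck_of_word r b = deck_of_word r b'"
  using assms by (induction r) auto

lemma deck_of_word_permutes: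
  assumes "\<And>j. j < r \<Longrightarrow> b j \<in> {1..n}"
  shows "deck_of_word r b permutes {1..n}"
  using assms
proof (induction r)
  case 0
  show ?case unfolding deck_of_word.simps by (rule permutes_id)
next
  case (Suc r)
  then show ?case unfolding deck_of_word.simps by (intro move_to_top_permutes) auto
qed

text \<open>The letters of a uniform word are independent, so the last one can be split off. Writing
  it at index \<open>r\<close> does not affect the first \<open>r\<close> moves, which read only the
  letters below \<open>r\<close>.\<close>

lemma random_to_top_eq_word:
  "random_to_top n r = map_pmf (deck_of_word r) (Pi_pmf {..<r} 0 (\<lambda>_. pmf_of_set {1..n}))"
proof (induction r)
  case 0
  show ?case by (simp add: id_def)
next
  case (Suc r)
  let ?P = "pmf_of_set {1..n}" and ?W = "\<lambda>r. Pi_pmf {..<r} 0 (\<lambda>_. pmf_of_set {1..n})"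
  have upd: "deck_of_word (Suc r) (b(r := c)) = move_to_top c (deck_of_word r b)" for b c
    using deck_of_word_cong[of r "b(r := c)" b] by simp
  have "?W (Suc r) = map_pmf (\<lambda>(c, b). b(r := c)) (pair_pmf ?P (?W r))"
    unfolding lessThan_Suc by (rule Pi_pmf_insert) auto
  \<comment> \<open>\<open>Pi_pmf_insert\<close> draws the new letter first, whereas
    \<open>random_to_top\<close> draws the earlier deck first.\<close>
  also have "\<dots> = map_pmf (\<lambda>(b, c). b(r := c)) (pair_pmf (?W r) ?P)"
    by (subst pair_commute_pmf) (simp only: map_pmf_comp case_prod_unfold fst_conv snd_conv)
  finally have "map_pmf (deck_of_word (Suc r)) (?W (Suc r)) =
      map_pmf (\<lambda>(b, c). move_to_top c (deck_of_word r b)) (pair_pmf (?W r) ?P)"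
    by (simp only: map_pmf_comp case_prod_unfold upd)
  also have "\<dots> = random_to_top n (Suc r)"
    unfolding random_to_top.simps Suc
    by (simp only: pair_pmf_def map_bind_pmf map_return_pmf bind_map_pmf prod.case
        map_pmf_def[of "\<lambda>c. move_to_top c _"])
  finally show ?case ..
qed

section \<open>The block of selected cards on top and the order below it\<close>

lemma inv_permutes_eqI: "f permutes A \<Longrightarrow> f x = y \<Longrightarrow> inv f y = x"
  by (auto simp: permutes_inverses)

text \<open>The move only rotates the positions down to that of \<open>c\<close>, all within the top
  \<open>k\<close>. Inclusion is checked entry by entry; equality follows by counting, as both decks
  are injective.\<close>

lemma move_to_top_image_old:
  fixes \<sigma> :: "nat \<Rightarrow> nat"
  assumes \<sigma>: "\<sigma> permutes {1..n}" and c: "c \<in> \<sigma> ` {1..k}" and k: "k \<le> n"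
  shows "move_to_top c \<sigma> ` {1..k} = \<sigma> ` {1..k}"
proof (rule card_seteq)
  obtain p where p: "p \<in> {1..k}" "c = \<sigma> p" using c by auto
  have inv: "inv \<sigma> c = p" using inv_permutes_eqI[OF \<sigma>] p by auto
  have "c \<in> {1..n}" using p k permutes_in_image[OF \<sigma>, of p] by auto
  then have m: "move_to_top c \<sigma> permutes {1..n}" by (rule move_to_top_permutes[OF \<sigma>])
  show "move_to_top c \<sigma> ` {1..k} \<subseteq> \<sigma> ` {1..k}"
  proof (rule image_subsetI)
    fix i assume "i \<in> {1..k}"
    then have "i \<in> {1..k}" "1 < i \<Longrightarrow> i - 1 \<in> {1..k}" by auto
    then show "move_to_top c \<sigma> i \<in> \<sigma> ` {1..k}"
      unfolding move_to_top_def using c by (auto simp del: atLeastAtMost_iff)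
  qed
  show "card (\<sigma> ` {1..k}) \<le> card (move_to_top c \<sigma> ` {1..k})"
    by (simp add: card_image[OF inj_on_subset[OF permutes_inj[OF \<sigma>]]]
        card_image[OF inj_on_subset[OF permutes_inj[OF m]]])
qed simp

lemma inv_gt_of_notin_image:
  fixes \<sigma> :: "nat \<Rightarrow> nat"
  assumes \<sigma>: "\<sigma> permutes {1..n}" and c: "c \<in> {1..n}" "c \<notin> \<sigma> ` {1..k}"
  shows "k < inv \<sigma> c" "inv \<sigma> c \<le> n"
proof -
  have "inv \<sigma> c \<in> {1..n}" "\<sigma> (inv \<sigma> c) = c"
    using \<sigma> c permutes_in_image[OF permutes_inv[OF \<sigma>]] by (auto simp: permutes_inverses)
  moreover from this have "inv \<sigma> c \<notin> {1..k}" using c(2) by (metis imageI)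
  ultimately show "k < inv \<sigma> c" "inv \<sigma> c \<le> n" by auto
qed

text \<open>Since \<open>c\<close> comes from below position \<open>k\<close>, each of the top
  \<open>k\<close> cards shifts down by exactly one place and \<open>c\<close> fills the gap at
  position 1.\<close>

lemma move_to_top_image_new:
  fixes \<sigma> :: "nat \<Rightarrow> nat"
  assumes \<sigma>: "\<sigma> permutes {1..n}" and c: "c \<in> {1..n}" "c \<notin> \<sigma> ` {1..k}"
  shows "move_to_top c \<sigma> ` {1..Suc k} = insert c (\<sigma> ` {1..k})"
proof -
  have *: "{1..Suc k} = insert 1 (Suc ` {1..k})"
    unfolding image_Suc_atLeastAtMost by auto
  have "move_to_top c \<sigma> (Suc i) = \<sigma> i" if "i \<in> {1..k}" for i
    using that inv_gt_of_notin_image[OF \<sigma> c] by (auto simp: move_to_top_def)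
  then have "(\<lambda>i. move_to_top c \<sigma> (Suc i)) ` {1..k} = \<sigma> ` {1..k}" by (intro image_cong) auto
  moreover have "move_to_top c \<sigma> 1 = c" by (simp add: move_to_top_def)
  ultimately show ?thesis unfolding * image_insert image_image by simp
qed

lemma card_letters_le:
  assumes "\<And>j. j < r \<Longrightarrow> b j \<in> {1..n::nat}"
  shows "card (b ` {..<r}) \<le> n"
  using card_mono[of "{1..n}" "b ` {..<r}"] assms by force

text \<open>Selecting a card again only rearranges the block; selecting a new one enlarges the block
  and the set of letters by the same card.\<close>

lemma deck_of_word_image:
  assumes "\<And>j. j < r \<Longrightarrow> b j \<in> {1..n}"
  shows "deck_of_word r b ` {1..card (b ` {..<r})} = b ` {..<r}"
  using assms
proof (induction r)
  case 0
  show ?case by simp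
next
  case (Suc r)
  let ?\<sigma> = "deck_of_word r b" and ?k = "card (b ` {..<r})"
  have \<sigma>: "?\<sigma> permutes {1..n}" using Suc.prems by (intro deck_of_word_permutes) auto
  have k: "?k \<le> n" using Suc.prems by (intro card_letters_le[of r b n]) auto
  have IH: "?\<sigma> ` {1..?k} = b ` {..<r}" using Suc by simp
  have c: "b r \<in> {1..n}" using Suc.prems by blast
  show ?case
  proof (cases "b r \<in> b ` {..<r}")
    case True
    then show ?thesis
      using move_to_top_image_old[OF \<sigma> _ k, of "b r"] IH by (simp add: lessThan_Suc insert_absorb)
  next
    case False
    then show ?thesis
      using move_to_top_image_new[OF \<sigma> c, of ?k] IH by (simp add: lessThan_Suc)
  qed
qed

text \<open>The starting deck is increasing. A repeated letter changes nothing below the block, and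
  a new letter deletes one entry from an increasing sequence.\<close>

lemma deck_of_word_strict_mono:
  assumes "\<And>j. j < r \<Longrightarrow> b j \<in> {1..n}"
  shows "strict_mono_on {card (b ` {..<r})<..n} (deck_of_word r b)"
  using assms
proof (induction r)
  case 0
  show ?case by (simp add: strict_mono_on_def)
next
  case (Suc r)
  let ?\<sigma> = "deck_of_word r b" and ?k = "card (b ` {..<r})"
  have \<sigma>: "?\<sigma> permutes {1..n}" using Suc.prems by (intro deck_of_word_permutes) auto
  have img: "?\<sigma> ` {1..?k} = b ` {..<r}" using Suc.prems by (intro deck_of_word_image[of r b n]) auto
  have IH: "strict_mono_on {?k<..n} ?\<sigma>" using Suc by simp
  have c: "b r \<in> {1..n}" using Suc.prems by blast
  show ?case
  proof (cases "b r \<in> b ` {..<r}")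
    case True
    then have "b r \<in> ?\<sigma> ` {1..?k}" unfolding img .
    then obtain p where p: "p \<in> {1..?k}" "?\<sigma> p = b r" by auto
    have "inv ?\<sigma> (b r) = p" by (rule inv_permutes_eqI[OF \<sigma> p(2)])
    then have "move_to_top (b r) ?\<sigma> i = ?\<sigma> i" if "?k < i" for i
      using that p by (auto simp: move_to_top_def)
    then show ?thesis
      using True IH by (simp add: lessThan_Suc insert_absorb strict_mono_on_def)
  next
    case False
    then have p: "?k < inv ?\<sigma> (b r)" "inv ?\<sigma> (b r) \<le> n"
      using inv_gt_of_notin_image[OF \<sigma> c, of ?k] img by auto
    \<comment> \<open>The block has grown by one, so \<open>i - 1\<close> still exceeds
      \<open>?k\<close>; the hypothesis thus covers the entries read at \<open>i - 1\<close> and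
      \<open>j - 1\<close> as well.\<close>
    have "move_to_top (b r) ?\<sigma> i < move_to_top (b r) ?\<sigma> j" if "Suc ?k < i" "i < j" "j \<le> n" for i j
      using that p by (auto simp: move_to_top_def intro!: strict_mono_onD[OF IH])
    then show ?thesis
      using False by (simp add: lessThan_Suc strict_mono_on_def)
  qed
qed

text \<open>The order of the top block depends only on the pattern of repetitions in the word, which
  an injective relabelling preserves. Below the block this can fail: there both decks are
  increasing, whatever \<open>\<pi>\<close> is.\<close>

lemma deck_of_word_relabel:
  assumes "\<And>j. j < r \<Longrightarrow> b j \<in> {1..n}" and \<pi>: "\<pi> permutes {1..n}"
    and "i \<in> {1..card (b ` {..<r})}"
  shows "deck_of_word r (\<pi> \<circ> b) i = \<pi> (deck_of_word r b i)"
  using assms(1,3)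
proof (induction r arbitrary: i)
  case 0
  then show ?case by simp
next
  case (Suc r)
  let ?\<sigma> = "deck_of_word r b" and ?\<tau> = "deck_of_word r (\<pi> \<circ> b)" and ?k = "card (b ` {..<r})"
  have b: "\<And>j. j < r \<Longrightarrow> b j \<in> {1..n}" using Suc.prems by auto
  have \<pi>b: "\<And>j. j < r \<Longrightarrow> (\<pi> \<circ> b) j \<in> {1..n}"
    using b permutes_in_image[OF \<pi>] by (auto simp del: atLeastAtMost_iff)
  have \<sigma>: "?\<sigma> permutes {1..n}" by (rule deck_of_word_permutes[OF b])
  have \<tau>: "?\<tau> permutes {1..n}" by (rule deck_of_word_permutes[OF \<pi>b])
  have c: "b r \<in> {1..n}" using Suc.prems by blast
  have \<pi>c: "\<pi> (b r) \<in> {1..n}" using c permutes_in_image[OF \<pi>] by blast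
  have IH: "?\<tau> i = \<pi> (?\<sigma> i)" if "i \<in> {1..?k}" for i using Suc.IH b that by blast
  have img: "?\<sigma> ` {1..?k} = b ` {..<r}" by (rule deck_of_word_image[OF b])
  have "?\<tau> ` {1..?k} = \<pi> ` ?\<sigma> ` {1..?k}"
    unfolding image_image using IH by (rule image_cong[OF refl])
  then have img': "?\<tau> ` {1..?k} = \<pi> ` b ` {..<r}" unfolding img .
  show ?case
  proof (cases "b r \<in> b ` {..<r}")
    case True
    then have "b r \<in> ?\<sigma> ` {1..?k}" unfolding img .
    then obtain p where p: "p \<in> {1..?k}" "?\<sigma> p = b r" by auto
    have 1: "inv ?\<sigma> (b r) = p" by (rule inv_permutes_eqI[OF \<sigma> p(2)])
    \<comment> \<open>The selected card sits at the same position \<open>p\<close> in both decks, so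
      both moves rotate the same positions.\<close>
    have "?\<tau> p = \<pi> (b r)" using IH[OF p(1)] unfolding p(2) .
    then have 2: "inv ?\<tau> (\<pi> (b r)) = p" by (rule inv_permutes_eqI[OF \<tau>])
    have "i \<in> {1..?k}" using Suc.prems(2) True by (simp add: lessThan_Suc insert_absorb)
    then have "i = 1 \<or> 1 < i \<and> i - 1 \<in> {1..?k}" "i \<in> {1..?k}" by auto
    then show ?thesis
      unfolding deck_of_word.simps move_to_top_def comp_apply[of \<pi> b r] 1 2
      using IH[of i] IH[of "i - 1"] by auto
  next
    case False
    then have "\<pi> (b r) \<notin> \<pi> ` b ` {..<r}"
      using permutes_inj[OF \<pi>] by (simp add: inj_image_mem_iff)
    \<comment> \<open>The selected card may sit at different positions in the two decks, but both
      lie below the block, so the whole block shifts by one in each.\<close>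
    then have "?k < inv ?\<tau> (\<pi> (b r))"
      using inv_gt_of_notin_image[OF \<tau> \<pi>c, of ?k] img' by auto
    moreover have "?k < inv ?\<sigma> (b r)"
      using inv_gt_of_notin_image[OF \<sigma> c, of ?k] img False by auto
    moreover have "i \<in> {1..Suc ?k}" using Suc.prems(2) False by (simp add: lessThan_Suc)
    then have "i = 1 \<or> 1 < i \<and> i \<le> Suc ?k \<and> i - 1 \<in> {1..?k}" by auto
    ultimately show ?thesis
      unfolding deck_of_word.simps move_to_top_def comp_apply[of \<pi> b r]
      using IH[of "i - 1"] by auto
  qed
qed

section \<open>Counting the fixed points\<close>

text \<open>Both conditions say that the cards at positions \<open>{i..n}\<close> are exactly
  \<open>{i..n}\<close>, so that none of these cards lies in the top block.\<close>

lemma fixed_point_iff_gt_Max: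
  fixes \<sigma> :: "nat \<Rightarrow> nat"
  assumes \<sigma>: "\<sigma> permutes {1..n}" and mono: "strict_mono_on {k<..n} \<sigma>"
    and k: "1 \<le> k" and i: "k < i" "i \<le> n"
  shows "\<sigma> i = i \<longleftrightarrow> Max (\<sigma> ` {1..k}) < i"
proof -
  let ?M = "Max (\<sigma> ` {1..k})"
  have inj: "inj_on \<sigma> A" for A using permutes_inj[OF \<sigma>] inj_on_subset by blast
  have range: "\<sigma> j \<in> {1..n}" if "j \<in> {1..n}" for j using that permutes_in_image[OF \<sigma>] by blast
  have sub: "\<sigma> ` {j..n} \<subseteq> {\<sigma> j..n}" if "k < j" for j
  proof (rule image_subsetI)
    fix x assume x: "x \<in> {j..n}"
    have "\<sigma> j \<le> \<sigma> x"
      using that x strict_mono_onD[OF mono, of j x] by (cases "j = x") (auto intro: less_imp_le)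
    then show "\<sigma> x \<in> {\<sigma> j..n}" using range[of x] that x by auto
  qed
  \<comment> \<open>The \<open>n - j + 1\<close> distinct cards from position \<open>j\<close> on
    all lie in \<open>{\<sigma> j..n}\<close>, which must be large enough to hold them.\<close>
  have le: "\<sigma> j \<le> j" if "k < j" "j \<le> n" for j
  proof -
    have "card (\<sigma> ` {j..n}) \<le> card {\<sigma> j..n}" using sub that by (intro card_mono) auto
    then show ?thesis using that by (simp add: card_image[OF inj])
  qed
  have card: "card (\<sigma> ` {i..n}) = card {i..n}" by (rule card_image[OF inj])
  have ne: "finite (\<sigma> ` {1..k})" "\<sigma> ` {1..k} \<noteq> {}" using k by auto
  show ?thesis
  proof
    assume fix_i: "\<sigma> i = i"
    have eq: "\<sigma> ` {i..n} = {i..n}"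
      using sub[OF i(1)] fix_i card by (intro card_subset_eq) auto
    obtain j where j: "j \<in> {1..k}" "?M = \<sigma> j" using Max_in[OF ne] by auto
    show "?M < i"
    proof (rule ccontr)
      assume "\<not> ?M < i"
      then have "\<sigma> j \<in> \<sigma> ` {i..n}" using eq j i range[of j] by auto
      then have "j \<in> {i..n}" using permutes_inj[OF \<sigma>] by (simp add: inj_image_mem_iff)
      then show False using j i by auto
    qed
  next
    assume M: "?M < i"
    \<comment> \<open>A card \<open>c \<ge> i\<close> exceeds every card of the block, so it lies
      below the block; by \<open>le\<close> its position is at least \<open>c\<close>, hence at
      least \<open>i\<close>.\<close>
    have "{i..n} \<subseteq> \<sigma> ` {i..n}"
    proof
      fix c assume c: "c \<in> {i..n}"
      have "c \<notin> \<sigma> ` {1..k}" using M c Max_ge[OF ne(1), of c] by (meson atLeastAtMost_iff leD order_trans)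
      then have p: "k < inv \<sigma> c" "inv \<sigma> c \<le> n"
        using inv_gt_of_notin_image[OF \<sigma>, of c k] c i by auto
      have "\<sigma> (inv \<sigma> c) = c" by (rule permutes_inverses(1)[OF \<sigma>])
      then show "c \<in> \<sigma> ` {i..n}" using le[OF p] p c by (intro image_eqI[of _ _ "inv \<sigma> c"]) auto
    qed
    then have "\<sigma> ` {i..n} = {i..n}" using card by (intro card_subset_eq[symmetric]) auto
    then have "\<sigma> i \<ge> i" using i by (metis atLeastAtMost_iff imageI order_refl)
    then show "\<sigma> i = i" using le[OF i] by simp
  qed
qed

text \<open>Below the block the fixed points are exactly the positions beyond the maximum of the
  block; the fixed points inside the block are counted one by one.\<close>

lemma num_fixed_points_eq:
  fixes \<sigma> :: "nat \<Rightarrow> nat"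
  assumes \<sigma>: "\<sigma> permutes {1..n}" and mono: "strict_mono_on {k<..n} \<sigma>"
    and k: "1 \<le> k" "k \<le> n"
  shows "int (num_fixed_points n \<sigma>) =
    int n - int (Max (\<sigma> ` {1..k})) + (\<Sum>i = 1..k. of_bool (\<sigma> i = i))"
proof -
  let ?M = "Max (\<sigma> ` {1..k})"
  have inj: "inj_on \<sigma> A" for A using permutes_inj[OF \<sigma>] inj_on_subset by blast
  have range: "\<sigma> j \<in> {1..n}" if "j \<in> {1..n}" for j using that permutes_in_image[OF \<sigma>] by blast
  have sub: "\<sigma> ` {1..k} \<subseteq> {1..?M}"
    using range k by fastforce
  \<comment> \<open>The block consists of \<open>k\<close> distinct positive numbers. This bound
    keeps the two kinds of fixed points disjoint.\<close>
  have kM: "k \<le> ?M" using card_mono[OF _ sub] by (simp add: card_image[OF inj])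
  have Mn: "?M \<le> n" using range k by (subst Max_le_iff) auto
  have "i \<in> {1..n} \<and> \<sigma> i = i \<longleftrightarrow> i \<in> {1..k} \<and> \<sigma> i = i \<or> i \<in> {?M<..n}" for i
    using fixed_point_iff_gt_Max[OF \<sigma> mono k(1), of i] kM k(2)
    unfolding atLeastAtMost_iff greaterThanAtMost_iff by linarith
  then have "{i \<in> {1..n}. \<sigma> i = i} = {i \<in> {1..k}. \<sigma> i = i} \<union> {?M<..n}" by blast
  moreover have "{i \<in> {1..k}. \<sigma> i = i} \<inter> {?M<..n} = {}" using kM by (auto simp del: Max_less_iff)
  ultimately have "num_fixed_points n \<sigma> = card {i \<in> {1..k}. \<sigma> i = i} + (n - ?M)"
    by (simp add: num_fixed_points_def card_Un_disjoint)
  moreover have "(\<Sum>i = 1..k. of_bool (\<sigma> i = i)) = int (card {i \<in> {1..k}. \<sigma> i = i})"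
    by (simp add: sum_of_bool_eq Int_def)
  ultimately show ?thesis using Mn by simp
qed

text \<open>The count needs only the block of the relabelled deck, and there that deck agrees with
  \<open>\<pi> \<circ> deck_of_word r b\<close>. For fixed \<open>b\<close> this leaves a function
  of \<open>\<pi>\<close> times a fixed permutation.\<close>

lemma num_fixed_points_relabel:
  assumes b: "\<And>j. j < r \<Longrightarrow> b j \<in> {1..n}" and \<pi>: "\<pi> permutes {1..n}" and r: "1 \<le> r"
  shows "int (num_fixed_points n (deck_of_word r (\<pi> \<circ> b))) =
    int n - int (Max ((\<pi> \<circ> deck_of_word r b) ` {1..card (b ` {..<r})}))
      + (\<Sum>i = 1..card (b ` {..<r}). of_bool ((\<pi> \<circ> deck_of_word r b) i = i))"
proof -
  let ?k = "card (b ` {..<r})"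
  have \<pi>b: "\<And>j. j < r \<Longrightarrow> (\<pi> \<circ> b) j \<in> {1..n}"
    using b permutes_in_image[OF \<pi>] by (auto simp del: atLeastAtMost_iff)
  have "card ((\<pi> \<circ> b) ` {..<r}) = ?k"
    unfolding image_comp[symmetric] using permutes_inj[OF \<pi>]
    by (intro card_image) (blast intro: inj_on_subset)
  then have mono: "strict_mono_on {?k<..n} (deck_of_word r (\<pi> \<circ> b))"
    using deck_of_word_strict_mono[of r "\<pi> \<circ> b" n, OF \<pi>b] by simp
  have k: "1 \<le> ?k" "?k \<le> n"
    using r card_letters_le[OF b] by (auto simp: Suc_le_eq card_gt_0_iff)
  have eq: "deck_of_word r (\<pi> \<circ> b) i = (\<pi> \<circ> deck_of_word r b) i" if "i \<in> {1..?k}" for i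
    using deck_of_word_relabel[OF b \<pi> that] by simp
  have img: "deck_of_word r (\<pi> \<circ> b) ` {1..?k} = (\<pi> \<circ> deck_of_word r b) ` {1..?k}"
    by (rule image_cong[OF refl eq])
  have "(\<Sum>i = 1..?k. of_bool (deck_of_word r (\<pi> \<circ> b) i = i))
      = (\<Sum>i = 1..?k. of_bool ((\<pi> \<circ> deck_of_word r b) i = i) :: int)"
    by (intro sum.cong refl) (use eq in auto)
  then show ?thesis
    using num_fixed_points_eq[OF deck_of_word_permutes[OF \<pi>b] mono k] img by simp
qed

section \<open>Invariance of the uniform laws\<close>

lemma map_pmf_permutations_comp_right:
  assumes \<tau>: "\<tau> permutes A" and "finite A"
  shows "map_pmf (\<lambda>\<pi>. \<pi> \<circ> \<tau>) (pmf_of_set {\<pi>. \<pi> permutes A}) = pmf_of_set {\<pi>. \<pi> permutes A}"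
proof (rule map_pmf_of_set_bij_betw)
  show "bij_betw (\<lambda>\<pi>. \<pi> \<circ> \<tau>) {\<pi>. \<pi> permutes A} {\<pi>. \<pi> permutes A}"
    using \<tau> by (intro bij_betw_byWitness[where f' = "\<lambda>\<pi>. \<pi> \<circ> inv \<tau>"])
      (auto simp: comp_assoc permutes_inv_o intro: permutes_compose permutes_inv)
  show "{\<pi>. \<pi> permutes A} \<noteq> {}" using \<tau> by blast
  show "finite {\<pi>. \<pi> permutes A}" using assms by (simp add: finite_permutations)
qed

lemma map_Pi_pmf_uniform_relabel:
  fixes \<pi> :: "nat \<Rightarrow> nat"
  assumes \<pi>: "\<pi> permutes {1..n}" and "1 \<le> n" "finite A"
  shows "map_pmf (\<lambda>b. \<pi> \<circ> b) (Pi_pmf A 0 (\<lambda>_. pmf_of_set {1..n})) =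
    Pi_pmf A 0 (\<lambda>_. pmf_of_set {1..n})"
proof -
  have "map_pmf \<pi> (pmf_of_set {1..n}) = pmf_of_set {1..n}"
    by (rule map_pmf_of_set_bij_betw[OF permutes_imp_bij[OF \<pi>]]) (use assms(2) in simp_all)
  \<comment> \<open>The default value lies outside \<open>{1..n}\<close>, so relabelling keeps it
    and the product law retains its form.\<close>
  moreover have "\<pi> 0 = 0" using permutes_not_in[OF \<pi>] by simp
  ultimately show ?thesis
    using Pi_pmf_map[of A \<pi> 0 0 "\<lambda>_. pmf_of_set {1..n}"] assms(3) by (simp del: One_nat_def)
qed

theorem theorem4p1:
  fixes n r :: nat
  assumes "n \<ge> 1" and "r \<ge> 1"
  shows "map_pmf (\<lambda>\<sigma>. int (num_fixed_points n \<sigma>)) (random_to_top n r) =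
         map_pmf (\<lambda>(K, \<pi>). int n - int (Max (\<pi> ` {1..K})) + (\<Sum>i = 1..K. of_bool (\<pi> i = i)))
           (pair_pmf (occupied_boxes r n) (pmf_of_set {\<pi>. \<pi> permutes {1..n}}))"
proof -
  define W where "W = Pi_pmf {..<r} 0 (\<lambda>_. pmf_of_set {1..n})"
  define U where "U = pmf_of_set {\<pi>. \<pi> permutes {1..n}}"
  define F where "F b = int (num_fixed_points n (deck_of_word r b))" for b
  define g :: "nat \<Rightarrow> (nat \<Rightarrow> nat) \<Rightarrow> int" where
    "g K \<pi> = int n - int (Max (\<pi> ` {1..K})) + (\<Sum>i = 1..K. of_bool (\<pi> i = i))" for K \<pi>
  define K where "K b = card (b ` {..<r})" for b :: "nat \<Rightarrow> nat"
  have U: "set_pmf U = {\<pi>. \<pi> permutes {1..n}}"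
    unfolding U_def
    by (rule set_pmf_of_set) (auto simp: finite_permutations intro!: exI[of _ id] permutes_id)
  have W: "b j \<in> {1..n}" if "b \<in> set_pmf W" "j < r" for b j
    using that assms(1) by (auto simp: W_def set_Pi_pmf PiE_dflt_def)
  have "map_pmf (\<lambda>\<sigma>. int (num_fixed_points n \<sigma>)) (random_to_top n r) = map_pmf F W"
    by (simp add: random_to_top_eq_word W_def F_def[abs_def] map_pmf_comp del: One_nat_def)
  \<comment> \<open>An independent uniform \<open>\<pi>\<close> is introduced as a dummy variable;
    for each of its values, relabelling the word by \<open>\<pi>\<close> does not change the law of
    the word.\<close>
  also have "\<dots> = bind_pmf U (\<lambda>\<pi>. map_pmf F W)" by simp
  also have "\<dots> = bind_pmf U (\<lambda>\<pi>. map_pmf F (map_pmf (\<lambda>b. \<pi> \<circ> b) W))"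
    using map_Pi_pmf_uniform_relabel[OF _ assms(1), of _ "{..<r}"]
    by (intro bind_pmf_cong refl) (simp add: U W_def del: One_nat_def)
  \<comment> \<open>Exchanging the two draws fixes the word \<open>b\<close>, hence also
    \<open>K b\<close>, while \<open>\<pi>\<close> remains uniform.\<close>
  also have "\<dots> = bind_pmf W (\<lambda>b. map_pmf (\<lambda>\<pi>. F (\<pi> \<circ> b)) U)"
    by (simp add: map_pmf_def bind_assoc_pmf bind_return_pmf) (rule bind_commute_pmf)
  also have "\<dots> = bind_pmf W (\<lambda>b. map_pmf (\<lambda>\<pi>. g (K b) (\<pi> \<circ> deck_of_word r b)) U)"
  proof (intro bind_pmf_cong map_pmf_cong refl)
    fix b \<pi> assume "b \<in> set_pmf W" "\<pi> \<in> set_pmf U"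
    then show "F (\<pi> \<circ> b) = g (K b) (\<pi> \<circ> deck_of_word r b)"
      unfolding F_def g_def K_def U
      by (intro num_fixed_points_relabel W assms(2)) auto
  qed
  \<comment> \<open>For fixed \<open>b\<close> the deck is a constant permutation, and right
    multiplication by it preserves the uniform law of \<open>\<pi>\<close>. The word then enters
    only through \<open>K b\<close>, which yields the independent pair.\<close>
  also have "\<dots> = bind_pmf W (\<lambda>b. map_pmf (g (K b)) U)"
  proof (intro bind_pmf_cong refl)
    fix b assume "b \<in> set_pmf W"
    then have "map_pmf (\<lambda>\<pi>. \<pi> \<circ> deck_of_word r b) U = U"
      unfolding U_def by (intro map_pmf_permutations_comp_right deck_of_word_permutes W) auto
    then have "map_pmf (g (K b)) U = map_pmf (g (K b)) (map_pmf (\<lambda>\<pi>. \<pi> \<circ> deck_of_word r b) U)"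
      by simp
    then show "map_pmf (\<lambda>\<pi>. g (K b) (\<pi> \<circ> deck_of_word r b)) U = map_pmf (g (K b)) U"
      by (simp add: map_pmf_comp)
  qed
  also have "\<dots> = map_pmf (\<lambda>(K, \<pi>). g K \<pi>) (pair_pmf (map_pmf K W) U)"
    by (simp add: pair_pmf_def map_pmf_def bind_assoc_pmf bind_return_pmf)
  finally show ?thesis
    by (simp add: g_def W_def U_def K_def[abs_def] occupied_boxes_def)
qed

end
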